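(* Let $L>0$ and let $\mathcal A$ be any nonadaptive horizon-independent linear-span method. If $\gamma:=\limsup_{N\to\infty}N\,\mathcal G_N(\mathcal A)<\infty$, then $$\liminf_{N\to\infty}N\,\mathcal G_N(\mathcal A)\ge\frac1{a_\gamma}>0,\qquad\text{where}\quad a_\gamma:=\frac{2+\gamma+\sqrt{\gamma^2+4\gamma}}{2}.$$
   Context: Fix $L>0$. $\mathcal F_{0,L}(\mathbb R^d)$ is the class of convex differentiable functions $f:\mathbb R^d\to\mathbb R$ that admit a minimizer and whose gradient is $L$-Lipschitz (Euclidean norm); $f_\star:=\min f$. A nonadaptive horizon-independent linear-span method $\mathcal A$ is given by a single infinite array of real coefficients $(\beta_{i,k})_{0\le i<k}$, fixed in advance (independent of $f$, of $x_0$, of the dimension, of all observed gradients, and of any stopping horizon). Applied to $f$ and $x_0$ it generates $x_k=x_0-\frac1L\sum_{i=0}^{k-1}\beta_{i,k}\nabla f(x_i)$, $k\ge1$. Its worst-case bound after $N$ iterations is $$\mathcal G_N(\mathcal A):=\sup_{d\ge1,\ f\in\mathcal F_{0,L}(\mathbb R^d),\ x_0\in\mathbb R^d,\ f(x_0)>f_\star}\frac{\|\nabla f(x_N)\|^2}{L(f(x_0)-f_\star)}.$$ *)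

theory Defs
  imports "HOL-Analysis.Analysis"
begin

text \<open>
  The supremum below ranges over all dimensions, so the spaces \<open>\<real>\<^sup>d\<close> cannot be given by
  separate types. They are realised inside one real inner product space, the space of finitely
  supported real sequences: \<open>Rd d\<close> consists of the sequences supported on \<open>{..<d}\<close>.
  All notions on \<open>\<real>\<^sup>d\<close> are the library ones relativised to \<open>Rd d\<close>; values of a function
  outside \<open>Rd d\<close> are irrelevant.
\<close>

typedef fseq = "{x :: nat \<Rightarrow> real. finite {i. x i \<noteq> 0}}"
  morphisms coord Abs_fseq
  by (rule exI[of _ "\<lambda>_. 0"]) simp

setup_lifting type_definition_fseq

lemma finite_coord [simp]: "finite {i. coord x i \<noteq> 0}"
  using coord[of x] by simp

lemma fseq_eqI: "(\<And>i. coord x i = coord y i) \<Longrightarrow> x = y"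
  by (simp add: coord_inject[symmetric] fun_eq_iff)

instantiation fseq :: real_vector
begin

lift_definition zero_fseq :: fseq is "\<lambda>_. 0" by simp

lift_definition plus_fseq :: "fseq \<Rightarrow> fseq \<Rightarrow> fseq" is "\<lambda>x y i. x i + y i"
  subgoal for x y by (rule finite_subset[of _ "{i. x i \<noteq> 0} \<union> {i. y i \<noteq> 0}"]) auto
  done

lift_definition minus_fseq :: "fseq \<Rightarrow> fseq \<Rightarrow> fseq" is "\<lambda>x y i. x i - y i"
  subgoal for x y by (rule finite_subset[of _ "{i. x i \<noteq> 0} \<union> {i. y i \<noteq> 0}"]) auto
  done

lift_definition uminus_fseq :: "fseq \<Rightarrow> fseq" is "\<lambda>x i. - x i"
  by simp

lift_definition scaleR_fseq :: "real \<Rightarrow> fseq \<Rightarrow> fseq" is "\<lambda>c x i. c * x i"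
  by (rule finite_subset) auto

instance
  by standard (transfer; auto simp: algebra_simps)+

end

lemma coord_simps [simp]:
  "coord 0 i = 0"
  "coord (x + y) i = coord x i + coord y i"
  "coord (x - y) i = coord x i - coord y i"
  "coord (- x) i = - coord x i"
  "coord (c *\<^sub>R x) i = c * coord x i"
  by (transfer; simp)+

instantiation fseq :: real_inner
begin

definition inner_fseq :: "fseq \<Rightarrow> fseq \<Rightarrow> real" where
  "inner_fseq x y = (\<Sum>i | coord x i \<noteq> 0. coord x i * coord y i)"

definition norm_fseq :: "fseq \<Rightarrow> real" where
  "norm_fseq x = sqrt (inner x x)"

definition dist_fseq :: "fseq \<Rightarrow> fseq \<Rightarrow> real" where
  "dist_fseq x y = norm (x - y)"

definition sgn_fseq :: "fseq \<Rightarrow> fseq" where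
  "sgn_fseq x = x /\<^sub>R norm x"

definition uniformity_fseq :: "(fseq \<times> fseq) filter" where
  "uniformity_fseq = (INF e\<in>{0<..}. principal {(x, y). dist x y < e})"

definition open_fseq :: "fseq set \<Rightarrow> bool" where
  "open_fseq U = (\<forall>x\<in>U. eventually (\<lambda>(x', y). x' = x \<longrightarrow> y \<in> U) uniformity)"

lemma inner_fseq_superset:
  assumes "finite A" "{i. coord x i \<noteq> 0} \<subseteq> A"
  shows "inner x y = (\<Sum>i\<in>A. coord x i * coord y i)"
  unfolding inner_fseq_def using assms by (intro sum.mono_neutral_left) auto

instance
proof
  fix x y z :: fseq and r :: real
  define A where "A = {i. coord x i \<noteq> 0} \<union> {i. coord y i \<noteq> 0}"
  have *: "inner u v = (\<Sum>i\<in>A. coord u i * coord v i)"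
    if "\<forall>i. coord x i = 0 \<longrightarrow> coord y i = 0 \<longrightarrow> coord u i = 0" for u v
    using that by (intro inner_fseq_superset) (auto simp: A_def)
  show "inner x y = inner y x"
    by (simp add: * mult.commute)
  show "inner (x + y) z = inner x z + inner y z"
    by (simp add: * distrib_right sum.distrib)
  show "inner (r *\<^sub>R x) y = r * inner x y"
    by (simp add: * sum_distrib_left mult.assoc)
  show "0 \<le> inner x x"
    by (simp add: * sum_nonneg)
  show "inner x x = 0 \<longleftrightarrow> x = 0"
  proof
    assume "inner x x = 0"
    then have "\<forall>i\<in>{i. coord x i \<noteq> 0}. coord x i * coord x i = 0"
      unfolding inner_fseq_def by (subst (asm) sum_nonneg_eq_0_iff) auto
    then show "x = 0"
      by (auto intro: fseq_eqI)
  qed (simp add: inner_fseq_def)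
qed (simp_all only: norm_fseq_def dist_fseq_def sgn_fseq_def uniformity_fseq_def open_fseq_def)

end

definition Rd :: "nat \<Rightarrow> fseq set" where
  "Rd d = {x. \<forall>i\<ge>d. coord x i = 0}"

lemma bij_betw_coord_Rd: "bij_betw coord (Rd d) (topspace (Euclidean_space d))"
proof -
  have "coord (Abs_fseq x) = x" if "\<forall>i\<ge>d. x i = 0" for x
  proof -
    have "{i. x i \<noteq> 0} \<subseteq> {..<d}"
      using that not_le by blast
    then show ?thesis
      by (simp add: Abs_fseq_inverse finite_subset)
  qed
  then show ?thesis
    unfolding topspace_Euclidean_space Rd_def
    by (intro bij_betw_byWitness[where f' = Abs_fseq]) (auto simp: coord_inverse)
qed

lemma inner_Rd: "x \<in> Rd d \<Longrightarrow> inner x y = (\<Sum>i<d. coord x i * coord y i)"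
  by (rule inner_fseq_superset) (auto simp: Rd_def not_le[symmetric])

lemma norm_Rd: "x \<in> Rd d \<Longrightarrow> norm x = sqrt (\<Sum>i<d. (coord x i)\<^sup>2)"
  by (simp add: norm_fseq_def inner_Rd power2_eq_square)

lemma subspace_Rd: "subspace (Rd d)"
  by (auto simp: subspace_def Rd_def)

definition is_gradient :: "nat \<Rightarrow> (fseq \<Rightarrow> real) \<Rightarrow> fseq \<Rightarrow> fseq \<Rightarrow> bool" where
  "is_gradient d f x g \<longleftrightarrow>
     g \<in> Rd d \<and> (f has_derivative (\<lambda>h. inner g h)) (at x within Rd d)"

definition grad :: "nat \<Rightarrow> (fseq \<Rightarrow> real) \<Rightarrow> fseq \<Rightarrow> fseq" where
  "grad d f x = (THE g. is_gradient d f x g)"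

lemma is_gradient_unique:
  assumes x: "x \<in> Rd d" and g: "is_gradient d f x g" "is_gradient d f x g'"
  shows "g = g'"
proof -
  define u where "u = g - g'"
  have line: "x + t *\<^sub>R u \<in> Rd d" for t
    using x g by (simp add: u_def is_gradient_def Rd_def)
  have *: "((\<lambda>t::real. f (x + t *\<^sub>R u)) has_real_derivative inner v u) (at 0)"
    if v: "is_gradient d f x v" for v
  proof -
    have "((\<lambda>t::real. x + t *\<^sub>R u) has_derivative (\<lambda>t. t *\<^sub>R u)) (at 0)"
      by (auto intro!: derivative_eq_intros)
    moreover have "(f has_derivative (\<lambda>h. inner v h))
        (at (x + 0 *\<^sub>R u) within range (\<lambda>t::real. x + t *\<^sub>R u))"
      using v line by (auto simp: is_gradient_def intro: has_derivative_subset)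
    ultimately have "((\<lambda>t::real. f (x + t *\<^sub>R u)) has_derivative (\<lambda>t. inner v (t *\<^sub>R u))) (at 0)"
      by (rule has_derivative_in_compose)
    then show ?thesis
      by (simp add: has_field_derivative_def mult.commute[of "inner v u"] mult_commute_abs)
  qed
  have "inner g u = inner g' u"
    using DERIV_unique[OF *[OF g(1)] *[OF g(2)]] .
  then have "inner u u = 0"
    by (simp add: u_def inner_diff_left)
  then show ?thesis
    by (simp add: u_def)
qed

lemma grad_eqI: "x \<in> Rd d \<Longrightarrow> is_gradient d f x g \<Longrightarrow> grad d f x = g"
  unfolding grad_def by (rule the_equality) (auto dest: is_gradient_unique)

definition smooth_convex :: "real \<Rightarrow> nat \<Rightarrow> (fseq \<Rightarrow> real) set" where
  "smooth_convex L d =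
     {f. convex_on (Rd d) f \<and> f differentiable_on Rd d \<and>
         (\<exists>x. is_arg_min f (\<lambda>x. x \<in> Rd d) x) \<and> L-lipschitz_on (Rd d) (grad d f)}"

definition min_value :: "nat \<Rightarrow> (fseq \<Rightarrow> real) \<Rightarrow> real" where
  "min_value d f = f (arg_min_on f (Rd d))"

text \<open>
  A method is a coefficient array \<open>\<beta>\<close>, of which only the entries \<open>\<beta> i k\<close> with \<open>i < k\<close> are
  used. For \<open>k = 0\<close> the sum is empty and the iterate is \<open>x0\<close>.
\<close>

context
  notes sum.cong [fundef_cong]
begin

function iterate ::
  "real \<Rightarrow> (nat \<Rightarrow> nat \<Rightarrow> real) \<Rightarrow> nat \<Rightarrow> (fseq \<Rightarrow> real) \<Rightarrow> fseq \<Rightarrow> nat \<Rightarrow> fseq" where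
  "iterate L \<beta> d f x0 k =
     x0 - (1 / L) *\<^sub>R (\<Sum>i<k. \<beta> i k *\<^sub>R grad d f (iterate L \<beta> d f x0 i))"
  by pat_completeness auto

termination
  by (relation "Wellfounded.measure (\<lambda>(L, \<beta>, d, f, x0, k). k)") auto

end

declare iterate.simps [simp del]

definition worst_case :: "real \<Rightarrow> (nat \<Rightarrow> nat \<Rightarrow> real) \<Rightarrow> nat \<Rightarrow> ereal" where
  "worst_case L \<beta> N =
     Sup {ereal ((norm (grad d f (iterate L \<beta> d f x0 N)))\<^sup>2 / (L * (f x0 - min_value d f))) | d f x0.
            d \<ge> 1 \<and> f \<in> smooth_convex L d \<and> x0 \<in> Rd d \<and> f x0 > min_value d f}"

definition a_const :: "real \<Rightarrow> real" where
  "a_const \<gamma> = (2 + \<gamma> + sqrt (\<gamma>\<^sup>2 + 4 * \<gamma>)) / 2"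

end

theory Submission
  imports Defs "HOL-Real_Asymp.Real_Asymp"
begin

text \<open>
  Test the method on the one-dimensional function with gradient \<open>L min(t, 1)\<close>, started at
  \<open>1 + M\<close>. Write \<open>h k\<close> for the sum of the coefficients of step \<open>k\<close>. If \<open>h k \<le> M\<close> for all
  \<open>k < N\<close>, then only the gradient \<open>L\<close> is observed before step \<open>N\<close>, so the \<open>N\<close>-th iterate is
  \<open>1 + M - h N\<close>. With \<open>u N = max {h k | k \<le> N} + 1/2\<close>, the choice \<open>M = u N - 1/2\<close>
  gives \<open>G N \<ge> 1 / u N\<close>, and the choice \<open>M = u (N-1) - 1/2\<close>, where the iterate may overshoot
  the minimiser, gives \<open>u N \<le> u (N-1) + 1 + sqrt (G N * u (N-1))\<close>. If eventually \<open>N * G N \<le> c\<close>,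
  the recursion bounds the slope of \<open>u\<close> asymptotically by the root \<open>a > 1\<close> of \<open>(a - 1)\<^sup>2 = c a\<close>,
  which is \<open>a_const c\<close>.
\<close>

declare One_nat_def [simp del]

section \<open>The test function and its smoothness class\<close>

definition fseq_unit :: fseq where "fseq_unit = Abs_fseq (\<lambda>i. if i = 0 then 1 else 0)"

lemma coord_fseq_unit: "coord fseq_unit i = (if i = 0 then 1 else 0)"
  unfolding fseq_unit_def by (subst Abs_fseq_inverse) auto

lemma fseq_unit_in_Rd: "fseq_unit \<in> Rd 1"
  by (simp add: Rd_def coord_fseq_unit)

lemma scaleR_fseq_unit_in_Rd: "c *\<^sub>R fseq_unit \<in> Rd 1"
  by (rule subspace_scale[OF subspace_Rd fseq_unit_in_Rd])

lemma inner_fseq_unit: "inner fseq_unit x = coord x 0"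
  by (simp add: inner_Rd[OF fseq_unit_in_Rd] coord_fseq_unit One_nat_def)

lemma norm_fseq_unit: "norm fseq_unit = 1"
  by (simp add: norm_fseq_def inner_fseq_unit coord_fseq_unit)

text \<open>A Huber function truncated on the right only: left of \<open>1\<close> it stays
  quadratic, so overshooting the minimizer \<open>0\<close> can produce an arbitrarily large
  gradient.\<close>

definition half_huber :: "real \<Rightarrow> real" where
  "half_huber t = (if t \<le> 1 then t\<^sup>2 / 2 else t - 1 / 2)"

lemma half_huber_deriv: "(half_huber has_real_derivative min t 1) (at t)"
proof -
  \<comment> \<open>The closures of the two pieces meet only at \<open>1\<close>, where values and
    slopes agree.\<close>
  have "((\<lambda>t. if t \<in> {..1} then t\<^sup>2 / 2 else t - 1 / 2) has_vector_derivative
      (if t \<in> {..1} then t else 1)) (at t within UNIV)"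
    by (rule has_vector_derivative_If_within_closures[where T = "{1<..}"])
      (auto simp flip: has_real_derivative_iff_has_vector_derivative intro!: derivative_eq_intros)
  moreover have "half_huber = (\<lambda>t. if t \<in> {..1} then t\<^sup>2 / 2 else t - 1 / 2)"
    by (auto simp: half_huber_def)
  ultimately show ?thesis
    by (simp add: min_def has_real_derivative_iff_has_vector_derivative)
qed

lemma convex_half_huber: "convex_on UNIV half_huber"
  by (rule convex_on_realI[where f' = "\<lambda>t. min t 1"]) (auto intro: half_huber_deriv)

lemma half_huber_nonneg: "half_huber t \<ge> 0"
  by (simp add: half_huber_def)

definition ridge :: "real \<Rightarrow> fseq \<Rightarrow> real" where
  "ridge L x = L * half_huber (coord x 0)"

lemma coord_0_has_derivative: "((\<lambda>x. coord x 0) has_derivative (\<lambda>h. coord h 0)) F"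
proof -
  have "bounded_linear (\<lambda>x. coord x 0)"
    using bounded_linear_inner_right[of fseq_unit] by (simp add: inner_fseq_unit)
  then show ?thesis by (rule bounded_linear_imp_has_derivative)
qed

lemma is_gradient_ridge:
  "is_gradient 1 (ridge L) x ((L * min (coord x 0) 1) *\<^sub>R fseq_unit)"
proof -
  have "((\<lambda>x. half_huber (coord x 0)) has_derivative (\<lambda>h. min (coord x 0) 1 * coord h 0))
      (at x within Rd 1)"
    using has_derivative_compose[OF coord_0_has_derivative
        half_huber_deriv[of "coord x 0", unfolded has_field_derivative_def]] .
  from has_derivative_mult_right[OF this, of L]
  show ?thesis
    by (simp add: is_gradient_def ridge_def[abs_def] inner_fseq_unit mult.assoc
        scaleR_fseq_unit_in_Rd)
qed

lemma grad_ridge: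
  "x \<in> Rd 1 \<Longrightarrow> grad 1 (ridge L) x = (L * min (coord x 0) 1) *\<^sub>R fseq_unit"
  by (rule grad_eqI[OF _ is_gradient_ridge])

lemma min_value_ridge:
  assumes "L \<ge> 0"
  shows "is_arg_min (ridge L) (\<lambda>x. x \<in> Rd 1) 0" "min_value 1 (ridge L) = 0"
proof -
  have ge: "ridge L x \<ge> 0" for x
    using assms by (simp add: ridge_def half_huber_nonneg)
  moreover have z: "ridge L 0 = 0" "0 \<in> Rd 1"
    by (simp_all add: ridge_def half_huber_def subspace_0[OF subspace_Rd])
  ultimately show *: "is_arg_min (ridge L) (\<lambda>x. x \<in> Rd 1) 0"
    by (simp add: is_arg_min_linorder)
  \<comment> \<open>\<open>arg_min_on\<close> is a choice; as \<open>0\<close> is a minimizer, the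
    chosen point is one too.\<close>
  then have "is_arg_min (ridge L) (\<lambda>x. x \<in> Rd 1) (arg_min_on (ridge L) (Rd 1))"
    unfolding arg_min_on_def arg_min_def by (rule someI)
  with z have "ridge L (arg_min_on (ridge L) (Rd 1)) \<le> 0"
    by (metis is_arg_min_linorder)
  with ge show "min_value 1 (ridge L) = 0"
    by (simp add: min_value_def order_antisym)
qed

text \<open>The Lipschitz bound holds because \<open>min t 1\<close> is nonexpansive in
  \<open>t\<close> and, by Cauchy-Schwarz, so is the coordinate map.\<close>

lemma ridge_smooth_convex:
  assumes "L \<ge> 0"
  shows "ridge L \<in> smooth_convex L 1"
proof -
  have "convex_on UNIV (ridge L)"
  proof (rule convex_onI)
    fix t :: real and x y :: fseq
    assume "0 < t" "t < 1"
    then have "half_huber ((1 - t) * coord x 0 + t * coord y 0)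
        \<le> (1 - t) * half_huber (coord x 0) + t * half_huber (coord y 0)"
      using convex_onD[OF convex_half_huber, of t "coord x 0" "coord y 0"] by simp
    from mult_left_mono[OF this assms]
    show "ridge L ((1 - t) *\<^sub>R x + t *\<^sub>R y) \<le> (1 - t) * ridge L x + t * ridge L y"
      by (simp add: ridge_def algebra_simps)
  qed simp
  then have "convex_on (Rd 1) (ridge L)"
    by (rule convex_on_subset) (auto simp: subspace_imp_convex subspace_Rd)
  moreover have "ridge L differentiable_on Rd 1"
    using is_gradient_ridge unfolding is_gradient_def differentiable_on_def differentiable_def
    by blast
  moreover have "L-lipschitz_on (Rd 1) (grad 1 (ridge L))"
  proof (rule lipschitz_onI)
    fix x y assume xy: "x \<in> Rd 1" "y \<in> Rd 1"
    have "dist (grad 1 (ridge L) x) (grad 1 (ridge L) y)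
        = norm ((L * (min (coord x 0) 1 - min (coord y 0) 1)) *\<^sub>R fseq_unit)"
      using xy by (simp add: dist_norm grad_ridge algebra_simps)
    also have "\<dots> = L * \<bar>min (coord x 0) 1 - min (coord y 0) 1\<bar>"
      using assms by (simp add: norm_fseq_unit abs_mult)
    also have "\<dots> \<le> L * \<bar>coord x 0 - coord y 0\<bar>"
      using assms by (intro mult_left_mono) auto
    also have "\<bar>coord x 0 - coord y 0\<bar> \<le> dist x y"
      using Cauchy_Schwarz_ineq2[of fseq_unit "x - y"]
      by (simp add: inner_fseq_unit norm_fseq_unit dist_norm)
    finally show "dist (grad 1 (ridge L) x) (grad 1 (ridge L) y) \<le> L * dist x y"
      using assms by (simp add: mult_left_mono)
  qed (fact assms)
  ultimately show ?thesis
    using min_value_ridge(1)[OF assms] by (auto simp: smooth_convex_def)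
qed

lemma worst_case_ge:
  assumes "d \<ge> 1" "f \<in> smooth_convex L d" "x0 \<in> Rd d" "f x0 > min_value d f"
  shows "worst_case L \<beta> N \<ge>
    ereal ((norm (grad d f (iterate L \<beta> d f x0 N)))\<^sup>2 / (L * (f x0 - min_value d f)))"
  unfolding worst_case_def using assms by (intro Sup_upper) blast

section \<open>The method on the test function\<close>

definition total_step :: "(nat \<Rightarrow> nat \<Rightarrow> real) \<Rightarrow> nat \<Rightarrow> real" where
  "total_step \<beta> k = (\<Sum>i<k. \<beta> i k)"

text \<open>While all earlier points have coordinate at least \<open>1\<close>, every observed
  gradient is the same vector. The bound \<open>M\<close> concerns only steps before
  \<open>N\<close>, so step \<open>N\<close> itself may exceed it.\<close>

lemma iterate_ridge:
  assumes L: "L > 0" and M: "\<And>k. k < N \<Longrightarrow> total_step \<beta> k \<le> M"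
  shows "k \<le> N \<Longrightarrow>
    iterate L \<beta> 1 (ridge L) ((1 + M) *\<^sub>R fseq_unit) k = (1 + M - total_step \<beta> k) *\<^sub>R fseq_unit"
proof (induction k rule: less_induct)
  case (less k)
  let ?x = "iterate L \<beta> 1 (ridge L) ((1 + M) *\<^sub>R fseq_unit)"
  have "grad 1 (ridge L) (?x i) = L *\<^sub>R fseq_unit" if "i < k" for i
  proof -
    have "?x i = (1 + M - total_step \<beta> i) *\<^sub>R fseq_unit"
      using less that by simp
    moreover have "total_step \<beta> i \<le> M"
      using M that less.prems by simp
    ultimately show ?thesis
      by (simp add: grad_ridge scaleR_fseq_unit_in_Rd coord_fseq_unit)
  qed
  then have "(\<Sum>i<k. \<beta> i k *\<^sub>R grad 1 (ridge L) (?x i)) = (\<Sum>i<k. (\<beta> i k * L) *\<^sub>R fseq_unit)"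
    by simp
  also have "\<dots> = (L * total_step \<beta> k) *\<^sub>R fseq_unit"
    by (simp add: total_step_def sum_distrib_left mult.commute flip: scaleR_sum_left)
  finally show ?case
    using L by (subst iterate.simps) (simp add: algebra_simps)
qed

lemma worst_case_ge_total_step:
  assumes L: "L > 0" and M: "\<And>k. k < N \<Longrightarrow> total_step \<beta> k \<le> M" "M \<ge> 0"
  shows "worst_case L \<beta> N \<ge> ereal ((min (1 + M - total_step \<beta> N) 1)\<^sup>2 / (M + 1 / 2))"
proof -
  let ?x0 = "(1 + M) *\<^sub>R fseq_unit"
  have f0: "ridge L ?x0 = L * (M + 1 / 2)"
    using M by (simp add: ridge_def half_huber_def coord_fseq_unit power2_eq_square algebra_simps)
  then have pos: "ridge L ?x0 > min_value 1 (ridge L)"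
    using L M by (simp add: min_value_ridge)
  have norm: "norm (grad 1 (ridge L) (iterate L \<beta> 1 (ridge L) ?x0 N))
      = L * \<bar>min (1 + M - total_step \<beta> N) 1\<bar>"
    using L by (simp add: iterate_ridge[OF L M(1)] grad_ridge[OF scaleR_fseq_unit_in_Rd] coord_fseq_unit
        norm_fseq_unit abs_mult)
  show ?thesis
    using worst_case_ge[OF _ ridge_smooth_convex scaleR_fseq_unit_in_Rd pos, of \<beta> N] L
    by (simp add: f0 norm min_value_ridge power_mult_distrib power2_eq_square)
qed

definition max_total_step :: "(nat \<Rightarrow> nat \<Rightarrow> real) \<Rightarrow> nat \<Rightarrow> real" where
  "max_total_step \<beta> N = Max (total_step \<beta> ` {..N})"

lemma total_step_le_max: "k \<le> N \<Longrightarrow> total_step \<beta> k \<le> max_total_step \<beta> N"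
  by (simp add: max_total_step_def)

lemma max_total_step_nonneg: "max_total_step \<beta> N \<ge> 0"
  using total_step_le_max[of 0 N \<beta>] by (simp add: total_step_def)

lemma max_total_step_Suc:
  "max_total_step \<beta> (Suc N) = max (total_step \<beta> (Suc N)) (max_total_step \<beta> N)"
  by (simp add: max_total_step_def atMost_Suc)

text \<open>With the running maximum as \<open>M\<close>, step \<open>N\<close> also stays on the
  linear piece, so the numerator is \<open>1\<close>.\<close>

lemma worst_case_ge_max_total_step:
  assumes "L > 0"
  shows "worst_case L \<beta> N \<ge> ereal (1 / (max_total_step \<beta> N + 1 / 2))"
  using worst_case_ge_total_step[OF assms total_step_le_max max_total_step_nonneg, of N N \<beta>]
    total_step_le_max[of N N \<beta>]
  by simp

text \<open>Here \<open>M\<close> covers only steps up to \<open>N\<close>; a long step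
  \<open>Suc N\<close> overshoots the minimizer, and the gradient bound limits how far.\<close>

lemma max_total_step_Suc_le:
  assumes L: "L > 0" and g: "worst_case L \<beta> (Suc N) \<le> ereal g"
  shows "max_total_step \<beta> (Suc N)
    \<le> max_total_step \<beta> N + 1 + sqrt (g * (max_total_step \<beta> N + 1 / 2))"
proof -
  let ?M = "max_total_step \<beta> N" and ?h = "total_step \<beta> (Suc N)"
  have M: "?M \<ge> 0" by (rule max_total_step_nonneg)
  have "ereal ((min (1 + ?M - ?h) 1)\<^sup>2 / (?M + 1 / 2)) \<le> ereal g"
    using worst_case_ge_total_step[OF L _ M, of "Suc N" \<beta>] total_step_le_max[of _ N \<beta>] g
    by (meson less_Suc_eq_le order_trans)
  then have "(min (1 + ?M - ?h) 1)\<^sup>2 \<le> g * (?M + 1 / 2)"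
    using M by (simp add: divide_le_eq)
  then have "\<bar>min (1 + ?M - ?h) 1\<bar> \<le> sqrt (g * (?M + 1 / 2))"
    by (metis real_sqrt_abs real_sqrt_le_iff)
  \<comment> \<open>Either the maximum is unchanged, or \<open>?h\<close> is the new one and
    \<open>1 + ?M - ?h\<close> is at least minus the root.\<close>
  then show ?thesis
    by (auto simp: max_total_step_Suc)
qed

section \<open>The scalar recursion\<close>

lemma a_const_root:
  assumes "c > 0"
  shows "a_const c > 1" "(a_const c - 1)\<^sup>2 = c * a_const c"
proof -
  have s: "(sqrt (c\<^sup>2 + 4 * c))\<^sup>2 = c\<^sup>2 + 4 * c"
    using assms by simp
  show "a_const c > 1"
    using assms by (simp add: a_const_def add_pos_nonneg)
  show "(a_const c - 1)\<^sup>2 = c * a_const c"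
    using s by (simp add: a_const_def field_simps power2_eq_square)
qed

text \<open>The slope \<open>a\<close> reproduces itself because
  \<open>1 + sqrt (c * a) = a\<close>. The term \<open>C * sqrt n\<close> accommodates the starting
  value, and its growth pays for the error it causes under the root.\<close>

lemma sqrt_recursion_step:
  fixes u v a c C n :: real
  assumes a: "a > 1" "(a - 1)\<^sup>2 = c * a" and c: "c > 0" and C: "C \<ge> 0" and n: "n \<ge> 1"
    and u: "0 \<le> u" "u \<le> a * n + C * sqrt n"
    and v: "v \<le> u + 1 + sqrt (c / (n + 1) * u)"
  shows "v \<le> a * (n + 1) + C * sqrt (n + 1)"
proof -
  define e where "e = C * sqrt n / (n + 1)"
  have e: "e \<ge> 0" using C n by (simp add: e_def)
  \<comment> \<open>Weakening \<open>a * n\<close> to \<open>a * (n + 1)\<close> makes the division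
    exact.\<close>
  have "c / (n + 1) * u \<le> c / (n + 1) * (a * (n + 1) + C * sqrt n)"
    using u(2) c n a by (intro mult_left_mono) (auto simp: algebra_simps)
  also have "\<dots> = c * a + c * e"
    using n by (simp add: e_def field_simps)
  \<comment> \<open>Completing the square needs only \<open>c \<le> a - 1\<close>, which follows
    from the equation for \<open>a\<close>.\<close>
  also have "\<dots> \<le> (a - 1 + e / 2)\<^sup>2"
  proof -
    have "c \<le> a - 1"
    proof -
      have "c * a \<le> (a - 1) * a"
        using a by (simp add: power2_eq_square mult_left_mono flip: a(2))
      then show ?thesis using a(1) by simp
    qed
    then have "c * e \<le> (a - 1) * e" using e by (rule mult_right_mono)
    moreover have "(a - 1 + e / 2)\<^sup>2 = (a - 1)\<^sup>2 + (a - 1) * e + e\<^sup>2 / 4"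
      by (simp add: power2_eq_square field_simps)
    ultimately show ?thesis using a(2) zero_le_power2[of e] by linarith
  qed
  finally have "sqrt (c / (n + 1) * u) \<le> a - 1 + e / 2"
    using a(1) e by (intro real_le_lsqrt) auto
  \<comment> \<open>Squaring reduces this to a polynomial inequality.\<close>
  moreover have "C * sqrt n + e / 2 \<le> C * sqrt (n + 1)"
  proof -
    have "(sqrt n * (1 + 1 / (2 * (n + 1))))\<^sup>2 = n * (1 + 1 / (2 * (n + 1)))\<^sup>2"
      using n by (simp add: power_mult_distrib)
    also have "\<dots> = n + 1 - (3 * n + 4) / (4 * (n + 1)\<^sup>2)"
    proof -
      have "n + 1 \<noteq> 0" using n by simp
      then show ?thesis by (simp add: divide_simps) algebra
    qed
    also have "\<dots> \<le> n + 1"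
      using n by simp
    finally have "sqrt n * (1 + 1 / (2 * (n + 1))) \<le> sqrt (n + 1)"
      by (rule real_le_rsqrt)
    from mult_left_mono[OF this C] show ?thesis
      by (simp add: e_def algebra_simps)
  qed
  ultimately show ?thesis using u(2) v by (simp add: algebra_simps)
qed

lemma sqrt_recursion_bound:
  fixes u :: "nat \<Rightarrow> real"
  assumes c: "c > 0" and u: "\<And>n. u n \<ge> 0"
    and step: "\<forall>\<^sub>F n in sequentially. u (Suc n) \<le> u n + 1 + sqrt (c / (real n + 1) * u n)"
  obtains C where "\<forall>\<^sub>F n in sequentially. u n \<le> a_const c * n + C * sqrt n"
proof -
  from step obtain m where
    m: "\<And>n. n \<ge> m \<Longrightarrow> u (Suc n) \<le> u n + 1 + sqrt (c / (real n + 1) * u n)"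
    by (auto simp: eventually_sequentially)
  \<comment> \<open>\<open>k \<ge> 1\<close> gives \<open>sqrt k \<ge> 1\<close>, so
    \<open>C = u k\<close> settles the base case.\<close>
  define k where "k = max m 1"
  have k: "k \<ge> m" "k \<ge> 1" by (auto simp: k_def)
  have "u n \<le> a_const c * n + u k * sqrt n" if "n \<ge> k" for n
    using that
  proof (induction n rule: dec_induct)
    case base
    have "u k * 1 \<le> u k * sqrt k"
      using u k by (intro mult_left_mono) auto
    moreover have "a_const c * k \<ge> 0" using a_const_root(1)[OF c] by simp
    ultimately show ?case by simp
  next
    case (step n)
    then show ?case
      using sqrt_recursion_step[OF a_const_root[OF c] c u, of n "u n" k "u (Suc n)"] u[of n] m[of n] k
      by (simp add: add.commute)
  qed
  then show thesis
    by (intro that[of "u k"]) (auto simp: eventually_sequentially)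
qed

section \<open>Passage to the limit\<close>

lemma liminf_worst_case_ge:
  assumes L: "L > 0" and c: "c > 0"
    and lim: "limsup (\<lambda>N. ereal (real N) * worst_case L \<beta> N) < ereal c"
  shows "liminf (\<lambda>N. ereal (real N) * worst_case L \<beta> N) \<ge> ereal (1 / a_const c)"
proof -
  define u where "u N = max_total_step \<beta> N + 1 / 2" for N
  have u: "u N > 0" for N
    using max_total_step_nonneg[of \<beta> N] by (simp add: u_def)
  have a: "a_const c > 1" by (rule a_const_root(1)[OF c])
  have ev: "\<forall>\<^sub>F N in sequentially. ereal (real N) * worst_case L \<beta> N < ereal c"
    by (rule Limsup_lessD[OF lim])
  have "\<forall>\<^sub>F N in sequentially. u (Suc N) \<le> u N + 1 + sqrt (c / (real N + 1) * u N)"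
  proof -
    have "\<forall>\<^sub>F N in sequentially. ereal (real (Suc N)) * worst_case L \<beta> (Suc N) < ereal c"
      using ev by (subst eventually_sequentially_Suc)
    then show ?thesis
    proof eventually_elim
      case (elim N)
      \<comment> \<open>An infinite value would contradict the bound, since the factor
        \<open>Suc N\<close> is positive.\<close>
      then have "worst_case L \<beta> (Suc N) \<le> ereal (c / real (Suc N))"
        by (cases "worst_case L \<beta> (Suc N)") (auto simp: field_simps)
      from max_total_step_Suc_le[OF L this] show ?case
        by (simp add: u_def add.commute)
    qed
  qed
  with c u obtain C where C: "\<forall>\<^sub>F n in sequentially. u n \<le> a_const c * n + C * sqrt n"
    using sqrt_recursion_bound[of c u] less_imp_le by metis
  have "(\<lambda>n. 1 / sqrt (real n)) \<longlonglongrightarrow> 0"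
    by real_asymp
  then have "(\<lambda>n. a_const c + C * (1 / sqrt (real n))) \<longlonglongrightarrow> a_const c + C * 0"
    by (intro tendsto_intros)
  then have "(\<lambda>n. 1 / (a_const c + C * (1 / sqrt (real n)))) \<longlonglongrightarrow> 1 / a_const c"
    using a by (intro tendsto_divide tendsto_const) auto
  then have "liminf (\<lambda>n. ereal (1 / (a_const c + C * (1 / sqrt (real n))))) = ereal (1 / a_const c)"
    by (intro lim_imp_Liminf) auto
  moreover have "liminf (\<lambda>n. ereal (1 / (a_const c + C * (1 / sqrt (real n)))))
      \<le> liminf (\<lambda>N. ereal (real N) * worst_case L \<beta> N)"
  proof (rule Liminf_mono)
    show "\<forall>\<^sub>F n in sequentially. ereal (1 / (a_const c + C * (1 / sqrt (real n))))
        \<le> ereal (real n) * worst_case L \<beta> n"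
      using C eventually_gt_at_top[of 0]
    proof eventually_elim
      case (elim n)
      have "real n = sqrt n * sqrt n" by simp
      then have "a_const c * n + C * sqrt n = n * (a_const c + C * (1 / sqrt (real n)))"
        using elim(2) by (simp add: field_simps)
      then have "u n / n \<le> a_const c + C * (1 / sqrt (real n))"
        using elim by (simp add: divide_le_eq mult.commute)
      \<comment> \<open>The sign of \<open>C\<close> is unknown; this keeps the denominator positive
        when reciprocals are taken.\<close>
      moreover have "u n / n > 0" using u elim(2) by simp
      ultimately have "1 / (a_const c + C * (1 / sqrt (real n))) \<le> real n * (1 / u n)"
        using frac_le[of 1 1 "u n / n"] by simp
      moreover have "ereal (real n * (1 / u n)) \<le> ereal (real n) * worst_case L \<beta> n"
        using ereal_mult_left_mono[OF worst_case_ge_max_total_step[OF L, of \<beta> n], of "ereal (real n)"]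
        by (simp add: u_def)
      ultimately show ?case
        by (meson ereal_less_eq(3) order_trans)
    qed
  qed
  ultimately show ?thesis by simp
qed

theorem corollary5:
  fixes L :: real and \<beta> :: "nat \<Rightarrow> nat \<Rightarrow> real"
  assumes "L > 0"
    and "limsup (\<lambda>N. ereal (real N) * worst_case L \<beta> N) < \<infinity>"
  shows "let \<gamma> = real_of_ereal (limsup (\<lambda>N. ereal (real N) * worst_case L \<beta> N))
         in liminf (\<lambda>N. ereal (real N) * worst_case L \<beta> N) \<ge> ereal (1 / a_const \<gamma>)
            \<and> 1 / a_const \<gamma> > 0"
proof -
  let ?G = "\<lambda>N. ereal (real N) * worst_case L \<beta> N"
  define \<gamma> where "\<gamma> = real_of_ereal (limsup ?G)"
  \<comment> \<open>Excludes the limsup \<open>-\<infinity>\<close>, so \<open>real_of_ereal\<close>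
    returns its true value.\<close>
  have "?G N \<ge> 0" for N
  proof -
    have "0 \<le> ereal (1 / (max_total_step \<beta> N + 1 / 2))"
      using max_total_step_nonneg[of \<beta> N] by simp
    then have "0 \<le> worst_case L \<beta> N"
      using worst_case_ge_max_total_step[OF assms(1)] order_trans by blast
    then show ?thesis by simp
  qed
  then have ge0: "0 \<le> limsup ?G"
    by (intro le_Limsup) auto
  then have lim: "limsup ?G = ereal \<gamma>" and \<gamma>: "\<gamma> \<ge> 0"
    using assms(2) by (auto simp: \<gamma>_def ereal_real real_of_ereal_pos)
  have a: "a_const \<gamma> > 0"
    using \<gamma> by (simp add: a_const_def add_pos_nonneg)
  \<comment> \<open>The previous bound needs \<open>c\<close> positive and strictly above the
    limsup; letting \<open>c\<close> decrease to \<open>\<gamma>\<close> also covers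
    \<open>\<gamma> = 0\<close>.\<close>
  have "((\<lambda>c. 1 / a_const c) \<longlongrightarrow> 1 / a_const \<gamma>) (at_right \<gamma>)"
    using a unfolding a_const_def by (intro tendsto_intros) auto
  then have "((\<lambda>c. ereal (1 / a_const c)) \<longlongrightarrow> ereal (1 / a_const \<gamma>)) (at_right \<gamma>)"
    by simp
  moreover have "\<forall>\<^sub>F c in at_right \<gamma>. ereal (1 / a_const c) \<le> liminf ?G"
    using eventually_at_right_less[of \<gamma>]
    by eventually_elim (use \<gamma> lim liminf_worst_case_ge[OF assms(1)] in auto)
  ultimately have "ereal (1 / a_const \<gamma>) \<le> liminf ?G"
    by (rule tendsto_upperbound) simp
  with a show ?thesis
    by (simp add: Let_def \<gamma>_def)
qed

end
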